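(* Let $N\ge1$, $G>0$, $\varepsilon>0$, $\gamma\ge0$, $\mathrm{Re}^{-1}\ge0$, let $N_x\ge1$, $\Delta x>0$, $\Delta t>0$, and let $b_i=\partial_xh_b(x_i)$, $i=1,\ldots,N_x$, be given bottom-slope samples. Suppose that stored data $U_i^*\in\mathcal A_N$ and $K_i\in\mathbb R^{2N+3}$ ($i=1,\ldots,N_x$) and $U_{i+\frac12}^*\in\mathcal A_N$ ($i=0,\ldots,N_x$), with every $A_G(U_i^* )$ invertible, satisfy exactly, for $i=1,\ldots,N_x$, $$K_i=-A_G(U_i^* )^{-1}\big(S_x(U_i^* )\,b_i+R(U_i^* )\big),\qquad U_i^*-\tfrac{\Delta x}{2}K_i=U_{i-\frac12}^*,\qquad U_{i+\frac12}^*=U_i^*+\tfrac{\Delta x}{2}K_i,$$ and that the same functions $A_G,S_x,R$, the same samples $b_i$ and the same stored interface states $U_{i+\frac12}^*$ are used in the reconstruction, volume correction and boundary states of the finite-volume scheme described in the context. Then both the first-order method (zero slopes, forward Euler) and the second-order method (minmod slopes, SSP-RK2) preserve the discrete equilibrium exactly in exact arithmetic: if $U_i^n=U_i^*$ for all $i=1,\ldots,N_x$, then $U_i^{n+1}=U_i^*$ for all $i=1,\ldots,N_x$.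
   Context: **State space and $A_G$.** $\mathcal A_N=\{U\in\mathbb R^{2N+3}:h>0\}$, $U=(h,hu_m,hv_m,h\alpha_1,h\beta_1,\ldots,h\alpha_N,h\beta_N)^T$ (so $u_m,v_m,\alpha_j,\beta_j$ are obtained by dividing components by $h$). $A_G(U)=\partial_UF_L(U)+P_1(U)+\Delta A(U)$, where $\partial_U$ is the Jacobian in the components of $U$, $$F_L(U)=\Big(hu_m,\;h\big(u_m^2+\sum_{j=1}^N\tfrac{\alpha_j^2}{2j+1}\big)+\tfrac12Gh^2,\;h\big(u_mv_m+\sum_{j=1}^N\tfrac{\alpha_j\beta_j}{2j+1}\big),\;2hu_m\alpha_1,\;h(u_m\beta_1+v_m\alpha_1),\ldots,2hu_m\alpha_N,\;h(u_m\beta_N+v_m\alpha_N)\Big)^T,$$ $P_1(U)=\mathrm{diag}(0_{3\times3},p(U),\ldots,p(U))$ ($N$ copies) with $p(U)=\begin{pmatrix}-u_m&0\\-v_m&0\end{pmatrix}$, and $\Delta A(U)$ has as its only nonzero entries, in the row of $hv_m$, the entry $-\beta_j/(2j+1)$ in the column of $h\alpha_j$ and the entry $\alpha_j/(2j+1)$ in the column of $h\beta_j$, $j=1,\ldots,N$. **Sources.** $S_x(U)=(0,Gh,0,\ldots,0)^T$ and $R(U)=(0,R^u,R^v,R^\alpha_1,R^\beta_1,\ldots,R^\alpha_N,R^\beta_N)^T$, where with $u_b=u_m+\sum_{j=1}^N\alpha_j$, $v_b=v_m+\sum_{j=1}^N\beta_j$, $$R^u=\tfrac{\gamma}{\varepsilon}u_b,\quad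 R^v=\tfrac{\gamma}{\varepsilon}v_b,\quad R^\alpha_i=(2i+1)\Big(\tfrac{\gamma}{\varepsilon}u_b+\tfrac{\mathrm{Re}^{-1}}{\varepsilon h}\sum_{j=1}^NC_{ij}\alpha_j\Big),\quad R^\beta_i=(2i+1)\Big(\tfrac{\gamma}{\varepsilon}v_b+\tfrac{\mathrm{Re}^{-1}}{\varepsilon h}\sum_{j=1}^NC_{ij}\beta_j\Big),$$ $C_{ij}=\int_0^1\phi_i'\phi_j'\,d\zeta$, and $\phi_j$ is the Legendre polynomial of degree $j$ shifted to $[0,1]$ and normalized by $\phi_j(0)=1$. The scheme discretizes $U_t+A_G(U)\partial_xU+S_x(U)\partial_xh_b+R(U)=0$ on uniform cells $I_i=[x_{i-\frac12},x_{i+\frac12}]$ of width $\Delta x$ and centre $x_i$, $i=1,\ldots,N_x$. **Reconstruction.** Given cell values $U_i$, set $V_i=U_i-U_i^*$ for $1\le i\le N_x$ and $V_0=V_{N_x+1}=0$. First-order method: $\sigma_i=0$. Second-order method: $\sigma_i=\operatorname{minmod}\big(\frac{V_i-V_{i-1}}{\Delta x},\frac{V_{i+1}-V_i}{\Delta x}\big)$ componentwise, where $\operatorname{minmod}(a,b)=\operatorname{sign}(a)\min(|a|,|b|)$ if $ab>0$ and $0$ if $ab\le0$. Interface traces: $U_{i+\frac12}^-=U_{i+\frac12}^*+V_i+\frac{\Delta x}2\sigma_i$ for $1\le i\le N_x$, and $U_{i+\frac12}^+=U_{i+\frac12}^*+V_{i+1}-\frac{\Delta x}2\sigma_{i+1}$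 for $0\le i\le N_x-1$. Boundary exterior states: $U_{\frac12}^-:=U_{\frac12}^*$ and $U_{N_x+\frac12}^+:=U_{N_x+\frac12}^*$. **Fluctuations.** For $U_L,U_R\in\mathcal A_N$ let $\mathcal Q(U_L,U_R)=\int_0^1A_G(U_L+s(U_R-U_L))(U_R-U_L)\,ds$, $c(U)=\sqrt{Gh+3\sum_{j=1}^N\frac{\alpha_j^2}{2j+1}}$, $\lambda_{\min}=u_m-c$, $\lambda_{\max}=u_m+c$, $s_L=\min(0,\lambda_{\min}(U_L),\lambda_{\min}(U_R))$, $s_R=\max(0,\lambda_{\max}(U_L),\lambda_{\max}(U_R))$. If $s_L<0<s_R$, put $U^{\mathrm{HLL}}=\frac{s_RU_R-s_LU_L-\mathcal Q(U_L,U_R)}{s_R-s_L}$, $D^-=s_L(U^{\mathrm{HLL}}-U_L)$, $D^+=s_R(U_R-U^{\mathrm{HLL}})$; if $s_L\ge0$, $(D^-,D^+)=(0,\mathcal Q)$; if $s_R\le0$, $(D^-,D^+)=(\mathcal Q,0)$. $D_{i+\frac12}^\pm$ denotes $D^\pm(U_{i+\frac12}^-,U_{i+\frac12}^+)$, $0\le i\le N_x$. **Volume correction and operator.** $$\mathcal C_i=\Delta x\Big[A_G(U_i)(K_i+\sigma_i)-A_G(U_i^* )K_i+\big(S_x(U_i)-S_x(U_i^* )\big)b_i+R(U_i)-R(U_i^* )\Big],$$ $$\mathcal L_i(U)=-\frac1{\Delta x}\big(D_{i+\frac12}^-+D_{i-\frac12}^++\mathcal C_i\big),\quad1\le i\le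 N_x.$$ **Time stepping.** First-order method: $U_i^{n+1}=U_i^n+\Delta t\,\mathcal L_i(U^n)$ with $\sigma_i=0$. Second-order method: $U_i^{(1)}=U_i^n+\Delta t\,\mathcal L_i(U^n)$, $U_i^{n+1}=\frac12U_i^n+\frac12\big(U_i^{(1)}+\Delta t\,\mathcal L_i(U^{(1)})\big)$ with the minmod slopes. *)

theory Defs
  imports
    "HOL-Analysis.Analysis"
    "HOL-Computational_Algebra.Polynomial"
    "Jordan_Normal_Form.Matrix"
    "Jordan_Normal_Form.Gauss_Jordan_Elimination"
begin

unbundle no vec_syntax

text \<open>
  The moment order \<open>N\<close> is an ordinary natural number; states are vectors of dimension \<open>2N+3\<close>
  (type of \<open>Jordan_Normal_Form\<close>, indices from 0), ordered as
  \<open>h, h u\<^sub>m, h v\<^sub>m, h \<alpha>\<^sub>1, h \<beta>\<^sub>1, \<dots>, h \<alpha>\<^sub>N, h \<beta>\<^sub>N\<close>. Hence \<open>h \<alpha>\<^sub>j\<close> sits at index \<open>2j+1\<close> and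
  \<open>h \<beta>\<^sub>j\<close> at index \<open>2j+2\<close>, for \<open>j = 1, \<dots>, N\<close>.
  Parameters: \<open>G\<close> is the gravity constant, \<open>\<epsilon>\<close> and \<open>\<gamma>\<close> are the parameters of the friction
  source, and \<open>\<rho>\<close> stands for the inverse Reynolds number.
\<close>

definition state_dim :: "nat \<Rightarrow> nat" where
  "state_dim N = 2 * N + 3"

definition state_space :: "nat \<Rightarrow> real vec set" where
  "state_space N = {U \<in> carrier_vec (state_dim N). U $ 0 > 0}"

definition height :: "real vec \<Rightarrow> real" where
  "height U = U $ 0"

definition u_mean :: "real vec \<Rightarrow> real" where
  "u_mean U = U $ 1 / U $ 0"

definition v_mean :: "real vec \<Rightarrow> real" where
  "v_mean U = U $ 2 / U $ 0"

definition alpha :: "real vec \<Rightarrow> nat \<Rightarrow> real" where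
  "alpha U j = U $ (2 * j + 1) / U $ 0"

definition beta :: "real vec \<Rightarrow> nat \<Rightarrow> real" where
  "beta U j = U $ (2 * j + 2) / U $ 0"

text \<open>
  The vector \<open>(a, b, c, f 1, g 1, \<dots>, f N, g N)\<close>: for \<open>k = 2j+1\<close> one has \<open>k div 2 = j\<close>, and
  for \<open>k = 2j+2\<close> one has \<open>k div 2 - 1 = j\<close>.
\<close>

definition moment_vec ::
  "nat \<Rightarrow> real \<Rightarrow> real \<Rightarrow> real \<Rightarrow> (nat \<Rightarrow> real) \<Rightarrow> (nat \<Rightarrow> real) \<Rightarrow> real vec" where
  "moment_vec N a b c f g = vec (state_dim N) (\<lambda>k.
     if k = 0 then a else if k = 1 then b else if k = 2 then c
     else if odd k then f (k div 2) else g (k div 2 - 1))"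

definition flux :: "nat \<Rightarrow> real \<Rightarrow> real vec \<Rightarrow> real vec" where
  "flux N G U =
     (let h = height U; u = u_mean U; v = v_mean U; a = alpha U; b = beta U in
      moment_vec N
        (h * u)
        (h * (u\<^sup>2 + (\<Sum>j=1..N. (a j)\<^sup>2 / (2 * real j + 1))) + 1/2 * G * h\<^sup>2)
        (h * (u * v + (\<Sum>j=1..N. a j * b j / (2 * real j + 1))))
        (\<lambda>j. 2 * h * u * a j)
        (\<lambda>j. h * (u * b j + v * a j)))"

text \<open>The Jacobian matrix: entry \<open>(i, k)\<close> is the partial derivative of component \<open>i\<close> with
  respect to component \<open>k\<close>.\<close>

definition jacobian :: "nat \<Rightarrow> (real vec \<Rightarrow> real vec) \<Rightarrow> real vec \<Rightarrow> real mat" where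
  "jacobian d F U = mat d d (\<lambda>(i, k). deriv (\<lambda>t. F (U + t \<cdot>\<^sub>v unit_vec d k) $ i) 0)"

definition P_one :: "nat \<Rightarrow> real vec \<Rightarrow> real mat" where
  "P_one N U = diag_block_mat
     (0\<^sub>m 3 3 # replicate N (mat_of_rows_list 2 [[- u_mean U, 0], [- v_mean U, 0]]))"

definition Delta_A :: "nat \<Rightarrow> real vec \<Rightarrow> real mat" where
  "Delta_A N U = mat (state_dim N) (state_dim N) (\<lambda>(i, k).
     if i = 2 \<and> 3 \<le> k then
       (if odd k then (let j = k div 2 in - beta U j / (2 * real j + 1))
        else (let j = k div 2 - 1 in alpha U j / (2 * real j + 1)))
     else 0)"

definition A_G :: "nat \<Rightarrow> real \<Rightarrow> real vec \<Rightarrow> real mat" where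
  "A_G N G U = jacobian (state_dim N) (flux N G) U + P_one N U + Delta_A N U"

definition S_x :: "nat \<Rightarrow> real \<Rightarrow> real vec \<Rightarrow> real vec" where
  "S_x N G U = moment_vec N 0 (G * height U) 0 (\<lambda>_. 0) (\<lambda>_. 0)"

text \<open>
  Shifted Legendre polynomial of degree \<open>j\<close> on \<open>[0,1]\<close>, normalized to take the value 1 at 0,
  by Rodrigues' formula \<open>\<phi>\<^sub>j(\<zeta>) = (1 / j!) (d/d\<zeta>)\<^sup>j (\<zeta> - \<zeta>\<^sup>2)\<^sup>j\<close>.
\<close>

definition legendre_shifted :: "nat \<Rightarrow> real poly" where
  "legendre_shifted j = Polynomial.smult (1 / fact j) ((pderiv ^^ j) ([:0, 1, -1:] ^ j))"

lemma coeff_0_funpow_pderiv: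
  fixes p :: "real poly"
  shows "coeff ((pderiv ^^ n) p) 0 = fact n * coeff p n"
proof -
  have "\<forall>k. fact k * coeff ((pderiv ^^ n) p) k = fact (k + n) * coeff p (k + n)"
  proof (induction n)
    case (Suc n)
    have "fact k * coeff ((pderiv ^^ Suc n) p) k = fact (k + Suc n) * coeff p (k + Suc n)" for k
    proof -
      have "fact k * coeff ((pderiv ^^ Suc n) p) k = fact (Suc k) * coeff ((pderiv ^^ n) p) (Suc k)"
        by (simp add: coeff_pderiv algebra_simps)
      also have "\<dots> = fact (Suc k + n) * coeff p (Suc k + n)"
        using Suc.IH by blast
      finally show ?thesis by simp
    qed
    then show ?case by blast
  qed simp
  from this[rule_format, of 0] show ?thesis by simp
qed

lemma legendre_shifted_at_0: "poly (legendre_shifted j) 0 = 1"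
proof -
  have eq: "[:0, 1, -1:] ^ j = Polynomial.monom 1 j * [:1, -1::real:] ^ j"
  proof -
    have "[:0, 1, -1::real:] = [:0, 1:] * [:1, -1:]" by simp
    then show ?thesis by (simp only: power_mult_distrib monom_altdef smult_1_left mult_smult_left)
  qed
  have "coeff ([:0, 1, -1::real:] ^ j) j = 1"
    unfolding eq by (simp add: coeff_monom_mult coeff_0_power)
  then show ?thesis
    by (simp add: legendre_shifted_def poly_0_coeff_0 coeff_0_funpow_pderiv)
qed

definition C_coeff :: "nat \<Rightarrow> nat \<Rightarrow> real" where
  "C_coeff i j = integral {0..1}
     (\<lambda>\<zeta>. poly (pderiv (legendre_shifted i)) \<zeta> * poly (pderiv (legendre_shifted j)) \<zeta>)"

definition R_source :: "nat \<Rightarrow> real \<Rightarrow> real \<Rightarrow> real \<Rightarrow> real vec \<Rightarrow> real vec" where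
  "R_source N \<epsilon> \<gamma> \<rho> U =
     (let h = height U;
          ub = u_mean U + (\<Sum>j=1..N. alpha U j);
          vb = v_mean U + (\<Sum>j=1..N. beta U j) in
      moment_vec N 0 (\<gamma> / \<epsilon> * ub) (\<gamma> / \<epsilon> * vb)
        (\<lambda>i. (2 * real i + 1) *
              (\<gamma> / \<epsilon> * ub + \<rho> / (\<epsilon> * h) * (\<Sum>j=1..N. C_coeff i j * alpha U j)))
        (\<lambda>i. (2 * real i + 1) *
              (\<gamma> / \<epsilon> * vb + \<rho> / (\<epsilon> * h) * (\<Sum>j=1..N. C_coeff i j * beta U j))))"

text \<open>
  Grid data: cell values are functions of the cell index \<open>i \<in> {1..Nx}\<close>. An interface quantity
  with half-integer index \<open>i + 1/2\<close> is a function of \<open>i \<in> {0..Nx}\<close>. \<open>Us\<close> and \<open>Uf\<close> are the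
  stored equilibrium data at cell centres and at interfaces.
\<close>

definition deviation :: "nat \<Rightarrow> nat \<Rightarrow> (nat \<Rightarrow> real vec) \<Rightarrow> (nat \<Rightarrow> real vec) \<Rightarrow> nat \<Rightarrow> real vec" where
  "deviation N Nx Us U i =
     (if 1 \<le> i \<and> i \<le> Nx then U i - Us i else 0\<^sub>v (state_dim N))"

definition minmod :: "real \<Rightarrow> real \<Rightarrow> real" where
  "minmod a b = (if a * b > 0 then sgn a * min \<bar>a\<bar> \<bar>b\<bar> else 0)"

definition zero_slope :: "nat \<Rightarrow> nat \<Rightarrow> real vec" where
  "zero_slope N i = 0\<^sub>v (state_dim N)"

definition minmod_slope ::
  "nat \<Rightarrow> nat \<Rightarrow> real \<Rightarrow> (nat \<Rightarrow> real vec) \<Rightarrow> (nat \<Rightarrow> real vec) \<Rightarrow> nat \<Rightarrow> real vec" where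
  "minmod_slope N Nx dx Us U i =
     (let V = deviation N Nx Us U in
      vec (state_dim N) (\<lambda>k. minmod ((V i $ k - V (i - 1) $ k) / dx) ((V (i + 1) $ k - V i $ k) / dx)))"

text \<open>Traces at the interface \<open>i + 1/2\<close>, \<open>0 \<le> i \<le> Nx\<close>, including the exterior states at the
  two boundaries; \<open>\<sigma>\<close> is the family of slopes.\<close>

definition trace_left ::
  "nat \<Rightarrow> nat \<Rightarrow> real \<Rightarrow> (nat \<Rightarrow> real vec) \<Rightarrow> (nat \<Rightarrow> real vec) \<Rightarrow>
   (nat \<Rightarrow> real vec) \<Rightarrow> (nat \<Rightarrow> real vec) \<Rightarrow> nat \<Rightarrow> real vec" where
  "trace_left N Nx dx Us Uf \<sigma> U i =
     (if i = 0 then Uf 0 else Uf i + deviation N Nx Us U i + (dx / 2) \<cdot>\<^sub>v \<sigma> i)"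

definition trace_right ::
  "nat \<Rightarrow> nat \<Rightarrow> real \<Rightarrow> (nat \<Rightarrow> real vec) \<Rightarrow> (nat \<Rightarrow> real vec) \<Rightarrow>
   (nat \<Rightarrow> real vec) \<Rightarrow> (nat \<Rightarrow> real vec) \<Rightarrow> nat \<Rightarrow> real vec" where
  "trace_right N Nx dx Us Uf \<sigma> U i =
     (if i = Nx then Uf Nx else Uf i + deviation N Nx Us U (i + 1) - (dx / 2) \<cdot>\<^sub>v \<sigma> (i + 1))"

definition path_integral :: "nat \<Rightarrow> real \<Rightarrow> real vec \<Rightarrow> real vec \<Rightarrow> real vec" where
  "path_integral N G UL UR = vec (state_dim N) (\<lambda>k.
     integral {0..1} (\<lambda>s. (A_G N G (UL + s \<cdot>\<^sub>v (UR - UL)) *\<^sub>v (UR - UL)) $ k))"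

definition wave_c :: "nat \<Rightarrow> real \<Rightarrow> real vec \<Rightarrow> real" where
  "wave_c N G U = sqrt (G * height U + 3 * (\<Sum>j=1..N. (alpha U j)\<^sup>2 / (2 * real j + 1)))"

definition lambda_min :: "nat \<Rightarrow> real \<Rightarrow> real vec \<Rightarrow> real" where
  "lambda_min N G U = u_mean U - wave_c N G U"

definition lambda_max :: "nat \<Rightarrow> real \<Rightarrow> real vec \<Rightarrow> real" where
  "lambda_max N G U = u_mean U + wave_c N G U"

definition speed_left :: "nat \<Rightarrow> real \<Rightarrow> real vec \<Rightarrow> real vec \<Rightarrow> real" where
  "speed_left N G UL UR = min 0 (min (lambda_min N G UL) (lambda_min N G UR))"

definition speed_right :: "nat \<Rightarrow> real \<Rightarrow> real vec \<Rightarrow> real vec \<Rightarrow> real" where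
  "speed_right N G UL UR = max 0 (max (lambda_max N G UL) (lambda_max N G UR))"

definition U_HLL :: "nat \<Rightarrow> real \<Rightarrow> real vec \<Rightarrow> real vec \<Rightarrow> real vec" where
  "U_HLL N G UL UR =
     (let sL = speed_left N G UL UR; sR = speed_right N G UL UR in
      (1 / (sR - sL)) \<cdot>\<^sub>v (sR \<cdot>\<^sub>v UR - sL \<cdot>\<^sub>v UL - path_integral N G UL UR))"

text \<open>
  The pair of fluctuations (minus, plus). The left speed is never positive and the right speed
  never negative, so the last branch is the case where the right speed is 0. For \<open>G > 0\<close> and
  states of positive height the two speeds are not both 0, so the order of the last two
  branches is immaterial.
\<close>

definition fluctuations :: "nat \<Rightarrow> real \<Rightarrow> real vec \<Rightarrow> real vec \<Rightarrow> real vec \<times> real vec" where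
  "fluctuations N G UL UR =
     (let sL = speed_left N G UL UR; sR = speed_right N G UL UR in
      if sL < 0 \<and> 0 < sR then
        (sL \<cdot>\<^sub>v (U_HLL N G UL UR - UL), sR \<cdot>\<^sub>v (UR - U_HLL N G UL UR))
      else if sL \<ge> 0 then (0\<^sub>v (state_dim N), path_integral N G UL UR)
      else (path_integral N G UL UR, 0\<^sub>v (state_dim N)))"

definition volume_correction ::
  "nat \<Rightarrow> real \<Rightarrow> real \<Rightarrow> real \<Rightarrow> real \<Rightarrow> real \<Rightarrow> (nat \<Rightarrow> real) \<Rightarrow> (nat \<Rightarrow> real vec) \<Rightarrow>
   (nat \<Rightarrow> real vec) \<Rightarrow> (nat \<Rightarrow> real vec) \<Rightarrow> (nat \<Rightarrow> real vec) \<Rightarrow> nat \<Rightarrow> real vec" where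
  "volume_correction N G \<epsilon> \<gamma> \<rho> dx b Us K \<sigma> U i =
     dx \<cdot>\<^sub>v (A_G N G (U i) *\<^sub>v (K i + \<sigma> i) - A_G N G (Us i) *\<^sub>v K i
        + b i \<cdot>\<^sub>v (S_x N G (U i) - S_x N G (Us i))
        + R_source N \<epsilon> \<gamma> \<rho> (U i) - R_source N \<epsilon> \<gamma> \<rho> (Us i))"

definition spatial_operator ::
  "nat \<Rightarrow> real \<Rightarrow> real \<Rightarrow> real \<Rightarrow> real \<Rightarrow> nat \<Rightarrow> real \<Rightarrow> (nat \<Rightarrow> real) \<Rightarrow> (nat \<Rightarrow> real vec) \<Rightarrow>
   (nat \<Rightarrow> real vec) \<Rightarrow> (nat \<Rightarrow> real vec) \<Rightarrow> (nat \<Rightarrow> real vec) \<Rightarrow> (nat \<Rightarrow> real vec) \<Rightarrow> nat \<Rightarrow> real vec" where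
  "spatial_operator N G \<epsilon> \<gamma> \<rho> Nx dx b Us K Uf \<sigma> U i =
     (let D = (\<lambda>i. fluctuations N G (trace_left N Nx dx Us Uf \<sigma> U i)
                                     (trace_right N Nx dx Us Uf \<sigma> U i)) in
      (- 1 / dx) \<cdot>\<^sub>v (fst (D i) + snd (D (i - 1))
                       + volume_correction N G \<epsilon> \<gamma> \<rho> dx b Us K \<sigma> U i))"

definition first_order_step ::
  "nat \<Rightarrow> real \<Rightarrow> real \<Rightarrow> real \<Rightarrow> real \<Rightarrow> nat \<Rightarrow> real \<Rightarrow> real \<Rightarrow> (nat \<Rightarrow> real) \<Rightarrow> (nat \<Rightarrow> real vec) \<Rightarrow>
   (nat \<Rightarrow> real vec) \<Rightarrow> (nat \<Rightarrow> real vec) \<Rightarrow> (nat \<Rightarrow> real vec) \<Rightarrow> nat \<Rightarrow> real vec" where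
  "first_order_step N G \<epsilon> \<gamma> \<rho> Nx dx dt b Us K Uf U i =
     U i + dt \<cdot>\<^sub>v spatial_operator N G \<epsilon> \<gamma> \<rho> Nx dx b Us K Uf (zero_slope N) U i"

definition second_order_step ::
  "nat \<Rightarrow> real \<Rightarrow> real \<Rightarrow> real \<Rightarrow> real \<Rightarrow> nat \<Rightarrow> real \<Rightarrow> real \<Rightarrow> (nat \<Rightarrow> real) \<Rightarrow> (nat \<Rightarrow> real vec) \<Rightarrow>
   (nat \<Rightarrow> real vec) \<Rightarrow> (nat \<Rightarrow> real vec) \<Rightarrow> (nat \<Rightarrow> real vec) \<Rightarrow> nat \<Rightarrow> real vec" where
  "second_order_step N G \<epsilon> \<gamma> \<rho> Nx dx dt b Us K Uf U i =
     (let L = (\<lambda>W. spatial_operator N G \<epsilon> \<gamma> \<rho> Nx dx b Us K Uf (minmod_slope N Nx dx Us W) W);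
          U1 = (\<lambda>i. U i + dt \<cdot>\<^sub>v L U i) in
      (1/2) \<cdot>\<^sub>v U i + (1/2) \<cdot>\<^sub>v (U1 i + dt \<cdot>\<^sub>v L U1 i))"

end

theory Submission
  imports Defs
begin

text \<open>
  At the stored equilibrium every deviation \<open>V\<^sub>i\<close> vanishes, hence so do the slopes, and both
  traces at an interface equal the stored interface state. A fluctuation between equal states is
  zero, and the volume correction cancels term by term. Thus the spatial operator vanishes at any
  grid function that agrees with the stored cell values, in particular at both Runge-Kutta stages.
\<close>

text \<open>A matrix sum takes its dimensions from its right summand, here \<open>Delta_A\<close>,
  which is built with explicit size.\<close>

lemma dim_A_G [simp]:
  "dim_row (A_G N G U) = state_dim N" "dim_col (A_G N G U) = state_dim N"
  by (simp_all add: A_G_def Delta_A_def)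

lemma A_G_carrier: "A_G N G U \<in> carrier_mat (state_dim N) (state_dim N)"
  by (intro carrier_matI) simp_all

lemma dim_moment_vec [simp]: "dim_vec (moment_vec N a b c f g) = state_dim N"
  by (simp add: moment_vec_def)

lemma S_x_carrier: "S_x N G U \<in> carrier_vec (state_dim N)"
  by (intro carrier_vecI) (simp add: S_x_def)

lemma R_source_carrier: "R_source N \<epsilon> \<gamma> \<rho> U \<in> carrier_vec (state_dim N)"
  by (intro carrier_vecI) (simp add: R_source_def Let_def)

lemma smult_zero_vec [simp]: "(c :: real) \<cdot>\<^sub>v 0\<^sub>v d = 0\<^sub>v d"
  by (intro eq_vecI) simp_all

text \<open>The increment \<open>U - U\<close> is zero, so the integrand vanishes at every point of
  the path, whatever entries \<open>A_G\<close> has there.\<close>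

lemma path_integral_same:
  assumes "U \<in> carrier_vec (state_dim N)"
  shows "path_integral N G U U = 0\<^sub>v (state_dim N)"
proof -
  have "A_G N G W *\<^sub>v (U - U) = 0\<^sub>v (state_dim N)" for W
    using assms by (intro eq_vecI) (simp_all add: scalar_prod_def)
  then show ?thesis
    by (intro eq_vecI) (simp_all add: path_integral_def)
qed

text \<open>With the path integral gone, the middle state is (sR U - sL U) / (sR - sL). The strict
  inequality of the speeds allows the quotient to be cancelled.\<close>

lemma U_HLL_same:
  assumes U: "U \<in> carrier_vec (state_dim N)"
    and speeds: "speed_left N G U U < speed_right N G U U"
  shows "U_HLL N G U U = U"
proof (rule eq_vecI)
  fix k assume "k < dim_vec U"
  with U speeds show "U_HLL N G U U $ k = U $ k"
    by (auto simp: U_HLL_def Let_def path_integral_same field_simps)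
qed (use U in \<open>simp add: U_HLL_def Let_def path_integral_same\<close>)

text \<open>In the HLL branch, sL < 0 < sR gives the strict inequality that makes the middle state
  equal to \<open>U\<close>. The other two branches return only zero or the path integral.\<close>

lemma fluctuations_same:
  assumes U: "U \<in> carrier_vec (state_dim N)"
  shows "fluctuations N G U U = (0\<^sub>v (state_dim N), 0\<^sub>v (state_dim N))"
  by (simp add: fluctuations_def Let_def path_integral_same[OF U] U_HLL_same[OF U]
      minus_cancel_vec[OF U])

lemma volume_correction_equilibrium:
  assumes "U i = Us i" "K i \<in> carrier_vec (state_dim N)" "\<sigma> i = 0\<^sub>v (state_dim N)"
  shows "volume_correction N G \<epsilon> \<gamma> \<rho> dx b Us K \<sigma> U i = 0\<^sub>v (state_dim N)"
proof -
  have "A_G N G (Us i) *\<^sub>v K i \<in> carrier_vec (state_dim N)"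
    using A_G_carrier assms(2) by (rule mult_mat_vec_carrier)
  then show ?thesis
    using assms S_x_carrier[of N G "Us i"] R_source_carrier[of N \<epsilon> \<gamma> \<rho> "Us i"]
    by (intro eq_vecI) (simp_all add: volume_correction_def)
qed

context
  fixes N Nx :: nat and Us W :: "nat \<Rightarrow> real vec"
  assumes Us_carrier: "\<And>i. i \<in> {1..Nx} \<Longrightarrow> Us i \<in> carrier_vec (state_dim N)"
    and W_eq: "\<And>i. i \<in> {1..Nx} \<Longrightarrow> W i = Us i"
begin

text \<open>The index is unrestricted: outside the grid the value is zero by definition, which
  covers the neighbours 0 and Nx + 1 that enter the minmod slopes.\<close>

lemma deviation_equilibrium: "deviation N Nx Us W i = 0\<^sub>v (state_dim N)"
  using W_eq Us_carrier by (simp add: deviation_def)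

lemma minmod_slope_equilibrium: "minmod_slope N Nx dx Us W i = 0\<^sub>v (state_dim N)"
  by (intro eq_vecI) (simp_all add: minmod_slope_def Let_def deviation_equilibrium minmod_def)

text \<open>The slopes stay abstract and need to vanish only on the grid cells, so one statement
  serves both the zero slopes and the minmod slopes.\<close>

lemma spatial_operator_equilibrium:
  assumes K: "\<And>i. i \<in> {1..Nx} \<Longrightarrow> K i \<in> carrier_vec (state_dim N)"
    and Uf: "\<And>i. i \<in> {0..Nx} \<Longrightarrow> Uf i \<in> carrier_vec (state_dim N)"
    and \<sigma>: "\<And>i. i \<in> {1..Nx} \<Longrightarrow> \<sigma> i = 0\<^sub>v (state_dim N)"
    and i: "i \<in> {1..Nx}"
  shows "spatial_operator N G \<epsilon> \<gamma> \<rho> Nx dx b Us K Uf \<sigma> W i = 0\<^sub>v (state_dim N)"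
proof -
  \<comment> \<open>For j = 0 this is the exterior boundary state; otherwise the trace comes from
    cell j.\<close>
  have left: "trace_left N Nx dx Us Uf \<sigma> W j = Uf j" if "j \<in> {0..Nx}" for j
    using that Uf[of j] \<sigma>[of j] by (simp add: trace_left_def deviation_equilibrium)
  \<comment> \<open>Here the trace comes from cell j + 1, which lies in the grid unless j = Nx, the
    other boundary.\<close>
  have right: "trace_right N Nx dx Us Uf \<sigma> W j = Uf j" if "j \<in> {0..Nx}" for j
    using that Uf[of j] \<sigma>[of "j + 1"] by (auto simp: trace_right_def deviation_equilibrium)
  have fluct: "fluctuations N G (trace_left N Nx dx Us Uf \<sigma> W j) (trace_right N Nx dx Us Uf \<sigma> W j)
      = (0\<^sub>v (state_dim N), 0\<^sub>v (state_dim N))" if "j \<in> {0..Nx}" for j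
    using that by (simp only: left right fluctuations_same Uf)
  \<comment> \<open>These index the left and right interfaces of cell i; since i is at least 1, the
    subtraction on naturals is not truncated.\<close>
  have "i - 1 \<in> {0..Nx}" "i \<in> {0..Nx}"
    using i by auto
  then show ?thesis
    using i by (simp add: spatial_operator_def Let_def fluct
        volume_correction_equilibrium W_eq K \<sigma> del: atLeastAtMost_iff)
qed

end

theorem proposition4p1:
  fixes N Nx n :: nat
    and G \<epsilon> \<gamma> \<rho> dx dt x_left :: real
    and h_b :: "real \<Rightarrow> real"
    and b :: "nat \<Rightarrow> real"
    and Us K Uf :: "nat \<Rightarrow> real vec"
    and U :: "nat \<Rightarrow> nat \<Rightarrow> real vec"
  assumes "N \<ge> 1" and "G > 0" and "\<epsilon> > 0" and "\<gamma> \<ge> 0" and "\<rho> \<ge> 0"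
    and "Nx \<ge> 1" and "dx > 0" and "dt > 0"
    and slopes: "\<And>i. i \<in> {1..Nx} \<Longrightarrow>
      (h_b has_real_derivative b i) (at (x_left + (real i - 1/2) * dx))"
    and cells: "\<And>i. i \<in> {1..Nx} \<Longrightarrow> Us i \<in> state_space N"
    and K_carrier: "\<And>i. i \<in> {1..Nx} \<Longrightarrow> K i \<in> carrier_vec (state_dim N)"
    and interfaces: "\<And>i. i \<in> {0..Nx} \<Longrightarrow> Uf i \<in> state_space N"
    and invertible: "\<And>i. i \<in> {1..Nx} \<Longrightarrow> invertible_mat (A_G N G (Us i))"
    and K_eq: "\<And>i. i \<in> {1..Nx} \<Longrightarrow>
      K i = - (the (mat_inverse (A_G N G (Us i)))
                 *\<^sub>v (b i \<cdot>\<^sub>v S_x N G (Us i) + R_source N \<epsilon> \<gamma> \<rho> (Us i)))"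
    and left_interface: "\<And>i. i \<in> {1..Nx} \<Longrightarrow> Us i - (dx / 2) \<cdot>\<^sub>v K i = Uf (i - 1)"
    and right_interface: "\<And>i. i \<in> {1..Nx} \<Longrightarrow> Uf i = Us i + (dx / 2) \<cdot>\<^sub>v K i"
    and equilibrium: "\<And>i. i \<in> {1..Nx} \<Longrightarrow> U n i = Us i"
  shows "((\<forall>i\<in>{1..Nx}. U (Suc n) i =
              first_order_step N G \<epsilon> \<gamma> \<rho> Nx dx dt b Us K Uf (U n) i)
            \<longrightarrow> (\<forall>i\<in>{1..Nx}. U (Suc n) i = Us i))
       \<and> ((\<forall>i\<in>{1..Nx}. U (Suc n) i =
              second_order_step N G \<epsilon> \<gamma> \<rho> Nx dx dt b Us K Uf (U n) i)
            \<longrightarrow> (\<forall>i\<in>{1..Nx}. U (Suc n) i = Us i))"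
proof -
  have Us: "Us i \<in> carrier_vec (state_dim N)" if "i \<in> {1..Nx}" for i
    using cells[OF that] by (simp add: state_space_def)
  have Uf: "Uf i \<in> carrier_vec (state_dim N)" if "i \<in> {0..Nx}" for i
    using interfaces[OF that] by (simp add: state_space_def)
  have first: "first_order_step N G \<epsilon> \<gamma> \<rho> Nx dx dt b Us K Uf (U n) i = Us i"
    if i: "i \<in> {1..Nx}" for i
  proof -
    have "spatial_operator N G \<epsilon> \<gamma> \<rho> Nx dx b Us K Uf (zero_slope N) (U n) i = 0\<^sub>v (state_dim N)"
      by (rule spatial_operator_equilibrium)
        (use Us Uf K_carrier equilibrium i in \<open>simp_all add: zero_slope_def\<close>)
    then show ?thesis
      using Us[OF i] by (simp add: first_order_step_def equilibrium[OF i])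
  qed
  \<comment> \<open>The slopes are recomputed from the argument, so each Runge-Kutta stage uses its
    own. Agreement with \<open>Us\<close> is asked only on the grid cells, which is all that is
    known of \<open>U1\<close>.\<close>
  define L where
    "L W = spatial_operator N G \<epsilon> \<gamma> \<rho> Nx dx b Us K Uf (minmod_slope N Nx dx Us W) W" for W
  have L: "L W i = 0\<^sub>v (state_dim N)" if "\<And>j. j \<in> {1..Nx} \<Longrightarrow> W j = Us j" "i \<in> {1..Nx}" for W i
    unfolding L_def
    by (rule spatial_operator_equilibrium[OF Us that(1) K_carrier Uf
          minmod_slope_equilibrium[OF Us that(1)] that(2)])
  define U1 where "U1 i = U n i + dt \<cdot>\<^sub>v L (U n) i" for i
  have U1: "U1 i = Us i" if "i \<in> {1..Nx}" for i
    using Us[OF that] L[of "U n", OF equilibrium that] by (simp add: U1_def equilibrium[OF that])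
  have second: "second_order_step N G \<epsilon> \<gamma> \<rho> Nx dx dt b Us K Uf (U n) i = Us i"
    if i: "i \<in> {1..Nx}" for i
  proof -
    have "second_order_step N G \<epsilon> \<gamma> \<rho> Nx dx dt b Us K Uf (U n) i
        = (1/2) \<cdot>\<^sub>v U n i + (1/2) \<cdot>\<^sub>v (U1 i + dt \<cdot>\<^sub>v L U1 i)"
      by (simp add: second_order_step_def Let_def U1_def[abs_def] L_def[abs_def])
    also have "\<dots> = (1/2) \<cdot>\<^sub>v Us i + (1/2) \<cdot>\<^sub>v Us i"
      using Us[OF i] L[of U1, OF U1 i] by (simp add: equilibrium[OF i] U1[OF i])
    also have "\<dots> = Us i"
      by (intro eq_vecI) simp_all
    finally show ?thesis .
  qed
  show ?thesis
    using first second by simp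
qed

end
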